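(* There is a deterministic online exploration algorithm with advice that, for every cycle graph $G$ on $n$ vertices with positive edge weights and every starting vertex $s$, given a suitable advice string of $\lceil \log_2 n\rceil$ bits, explores $G$ with cost exactly $\mathrm{cost}_{\mathrm{opt}}(G,s)$ (competitive ratio $1$).
   Context: Each edge $e$ has positive weight $c(e)$. Online exploration model: vertices have unique identifiers; a searcher starts at $s$ knowing only $s$; upon arriving at $v$ it learns identifiers of all neighbours of $v$ and weights of all incident edges; each edge traversal costs its weight; the searcher must perform a closed walk from $s$ visiting all vertices and returning to $s$. $\mathrm{cost}_{\mathrm{opt}}(G,s)$ is the minimum cost of such a closed walk. Advice model: before the exploration starts, an oracle that knows the entire graph, the starting vertex and the (deterministic) algorithm gives the searcher a bit string (the advice), which the algorithm may use in its decisions. *)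

theory Defs
  imports Complex_Main
begin

text \<open>Simple undirected graphs with weighted edges. An edge is the two-element set of its end
  vertices; the values of \<open>weight\<close> outside \<open>edges\<close> are irrelevant. Elements of type
  \<open>'v\<close> are the vertex identifiers.\<close>

record 'v wgraph =
  verts :: "'v set"
  edges :: "'v set set"
  weight :: "'v set \<Rightarrow> real"

definition positive_weights :: "'v wgraph \<Rightarrow> bool" where
  "positive_weights G \<longleftrightarrow> (\<forall>e\<in>edges G. weight G e > 0)"

definition cycle_graph :: "'v wgraph \<Rightarrow> bool" where
  "cycle_graph G \<longleftrightarrow>
     (\<exists>vs. distinct vs \<and> length vs \<ge> 3 \<and> set vs = verts G \<and>
           edges G = {{vs ! i, vs ! (Suc i mod length vs)} | i. i < length vs})"

text \<open>A walk is the list of its vertices in the order of the visits, repetitions included.\<close>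

definition walk_cost :: "'v wgraph \<Rightarrow> 'v list \<Rightarrow> real" where
  "walk_cost G w = (\<Sum>i<length w - 1. weight G {w ! i, w ! Suc i})"

definition exploration_tour :: "'v wgraph \<Rightarrow> 'v \<Rightarrow> 'v list \<Rightarrow> bool" where
  "exploration_tour G s w \<longleftrightarrow>
     w \<noteq> [] \<and> hd w = s \<and> last w = s \<and>
     successively (\<lambda>u v. {u, v} \<in> edges G) w \<and> set w = verts G"

text \<open>If some tour has cost \<open>cost_opt G s\<close> and the weights are positive, the infimum is a
  minimum.\<close>

definition cost_opt :: "'v wgraph \<Rightarrow> 'v \<Rightarrow> real" where
  "cost_opt G s = Inf {walk_cost G w | w. exploration_tour G s w}"

text \<open>What the searcher learns on arrival at \<open>v\<close>: the identifier of \<open>v\<close> and a partial map whose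
  domain is the set of neighbours of \<open>v\<close> and whose values are the weights of the corresponding
  edges.\<close>

type_synonym 'v view = "'v \<times> ('v \<Rightarrow> real option)"

definition local_view :: "'v wgraph \<Rightarrow> 'v \<Rightarrow> 'v view" where
  "local_view G v =
     (v, \<lambda>u. if {v, u} \<in> edges G then Some (weight G {v, u}) else None)"

text \<open>A deterministic online algorithm decides on the basis of the advice string and of the views
  collected so far, one for each arrival and starting with that of the start vertex: \<open>Some u\<close> is a
  move to the neighbour \<open>u\<close> of the current vertex, \<open>None\<close> ends the exploration.\<close>

type_synonym 'v algorithm = "bool list \<Rightarrow> 'v view list \<Rightarrow> 'v option"

inductive partial_run ::
  "'v algorithm \<Rightarrow> bool list \<Rightarrow> 'v wgraph \<Rightarrow> 'v \<Rightarrow> 'v list \<Rightarrow> bool"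
  for A :: "'v algorithm" and adv :: "bool list" and G :: "'v wgraph" and s :: 'v where
  start: "partial_run A adv G s [s]"
| move: "\<lbrakk>partial_run A adv G s w; A adv (map (local_view G) w) = Some u; {last w, u} \<in> edges G\<rbrakk>
    \<Longrightarrow> partial_run A adv G s (w @ [u])"

text \<open>There is at most one \<open>w\<close> with \<open>complete_run A adv G s w\<close>, and none if the algorithm does
  not halt or tries to move to a vertex that is not adjacent to the current one.\<close>

definition complete_run ::
  "'v algorithm \<Rightarrow> bool list \<Rightarrow> 'v wgraph \<Rightarrow> 'v \<Rightarrow> 'v list \<Rightarrow> bool" where
  "complete_run A adv G s w \<longleftrightarrow>
     partial_run A adv G s w \<and> A adv (map (local_view G) w) = None"

end

theory Submission
  imports Defs
begin

text \<open>Let \<open>W\<close> be the total weight. For any two edges, removing both splits the cycle into two arcs,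
  so a tour traverses the two edges at least twice in total. Hence a tour either uses every edge,
  at cost at least \<open>W\<close>, or omits one edge \<open>e\<close> and traverses all others at least twice, at cost at
  least \<open>2 (W - weight e)\<close>. Going around the cycle is therefore optimal unless some edge is
  heavier than \<open>W / 2\<close>, in which case depth-first search avoiding that edge is optimal.

  The advice has to distinguish the round trip from the choices of the edge to avoid. These are
  \<open>n + 1\<close> options, one too many. The searcher therefore leaves the start along the lighter of its
  two edges: that edge is never heavier than \<open>W / 2\<close>, and \<open>n\<close> options remain.\<close>

section \<open>Labelling the vertices of a cycle by integers\<close>

text \<open>\<open>v\<close> wraps the integer line around the cycle with period \<open>n\<close>.
  Arcs become integer intervals, and rotations and reflections become substitutions.\<close>

locale cyclic_labelling =
  fixes G :: "'v wgraph" and n :: nat and v :: "int \<Rightarrow> 'v"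
  assumes n_ge_3: "n \<ge> 3"
    and v_eq_iff: "v i = v j \<longleftrightarrow> i mod int n = j mod int n"
    and verts_eq: "verts G = range v"
    and edges_eq: "edges G = range (\<lambda>i. {v i, v (i + 1)})"
begin

lemma v_eq_imp_eq:
  assumes "v i = v j" "i < j + int n" "j < i + int n"
  shows "i = j"
proof -
  have "int n dvd i - j"
    using assms(1) by (simp add: v_eq_iff mod_eq_dvd_iff)
  moreover have "\<bar>i - j\<bar> < int n"
    using assms(2,3) by linarith
  ultimately show ?thesis
    using zdvd_imp_le[of "int n" "\<bar>i - j\<bar>"] by fastforce
qed

lemma v_cong_add: "v i = v j \<Longrightarrow> v (i + k) = v (j + k)"
  unfolding v_eq_iff by (metis mod_add_left_eq)

lemma v_add_period [simp]: "v (i + int n) = v i"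
  by (simp add: v_eq_iff)

text \<open>The two bounds put \<open>x\<close> at distance less than \<open>n\<close> from every
  element of \<open>{a..b}\<close>, so wrapping around cannot identify it with another position
  there.\<close>

lemma v_mem_image_iff:
  assumes "b < x + int n" "x < a + int n"
  shows "v x \<in> v ` {a..b} \<longleftrightarrow> x \<in> {a..b}"
proof
  assume "v x \<in> v ` {a..b}"
  then obtain y where "v x = v y" "y \<in> {a..b}"
    by auto
  then show "x \<in> {a..b}"
    using v_eq_imp_eq[of x y] assms by auto
qed auto

lemma obtain_representative:
  obtains j where "j \<in> {a..<a + int n}" "v j = v i"
proof
  have "0 < int n"
    using n_ge_3 by simp
  then show "a + (i - a) mod int n \<in> {a..<a + int n}"
    by simp
  show "v (a + (i - a) mod int n) = v i"
    by (simp add: v_eq_iff mod_add_right_eq)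
qed

lemma range_v: "v ` {a..<a + int n} = range v"
proof -
  have "v i \<in> v ` {a..<a + int n}" for i
    using obtain_representative[of a i] by (metis imageI)
  then show ?thesis
    by auto
qed

lemma card_verts: "card (verts G) = n"
proof -
  have "inj_on v {0..<0 + int n}"
    by (rule inj_onI, rule v_eq_imp_eq) auto
  then have "card (v ` {0..<0 + int n}) = n"
    by (simp add: card_image)
  then show ?thesis
    unfolding verts_eq range_v .
qed

abbreviation edge :: "int \<Rightarrow> 'v set" where
  "edge i \<equiv> {v i, v (i + 1)}"

lemma edge_cong: "v i = v j \<Longrightarrow> edge i = edge j"
  using v_cong_add[of i j 1] by simp

text \<open>If the edges agreed with their ends swapped, two steps forward would lead back to the
  same vertex, which \<open>n \<ge> 3\<close> excludes.\<close>

lemma edge_eq_imp: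
  assumes "edge i = edge j"
  shows "v i = v j"
proof (rule ccontr)
  assume "v i \<noteq> v j"
  then have "v i = v (j + 1)" "v (i + 1) = v j"
    using assms by (auto simp: doubleton_eq_iff)
  then have "v (j + 2) = v j"
    using v_cong_add[of i "j + 1" 1] by (simp add: add.assoc)
  then show False
    using v_eq_imp_eq[of "j + 2" j] n_ge_3 by simp
qed

lemma edges_eq_image: "edges G = edge ` {a..<a + int n}"
proof -
  have "edge i \<in> edge ` {a..<a + int n}" for i
    using obtain_representative[of a i] edge_cong by (metis (no_types, lifting) imageI)
  then show ?thesis
    unfolding edges_eq by auto
qed

lemma finite_edges: "finite (edges G)"
  unfolding edges_eq_image[of 0] by simp

lemma sum_edges: "(\<Sum>e\<in>edges G. f e) = (\<Sum>i\<in>{a..<a + int n}. f (edge i))"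
proof -
  have "inj_on edge {a..<a + int n}"
    by (rule inj_onI, rule v_eq_imp_eq, erule edge_eq_imp) auto
  then show ?thesis
    unfolding edges_eq_image[of a] by (simp add: sum.reindex)
qed

lemma edge_mem_iff: "{v i, u} \<in> edges G \<longleftrightarrow> u = v (i - 1) \<or> u = v (i + 1)"
proof
  assume "{v i, u} \<in> edges G"
  then obtain k where k: "{v i, u} = {v k, v (k + 1)}"
    unfolding edges_eq by auto
  then consider "v i = v k" "u = v (k + 1)" | "v i = v (k + 1)" "u = v k"
    by (auto simp: doubleton_eq_iff)
  then show "u = v (i - 1) \<or> u = v (i + 1)"
  proof cases
    case 1
    then show ?thesis
      using v_cong_add[of i k 1] by simp
  next
    case 2
    then show ?thesis
      using v_cong_add[of i "k + 1" "-1"] by simp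
  qed
next
  have "{v i, v (i - 1)} = edge (i - 1)"
    by auto
  then show "u = v (i - 1) \<or> u = v (i + 1) \<Longrightarrow> {v i, u} \<in> edges G"
    unfolding edges_eq by blast
qed

lemma shifted: "cyclic_labelling G n (\<lambda>i. v (k + i))"
proof
  show "v (k + i) = v (k + j) \<longleftrightarrow> i mod int n = j mod int n" for i j
    by (simp add: v_eq_iff mod_eq_dvd_iff)
  show "verts G = range (\<lambda>i. v (k + i))"
  proof -
    have "v i = v (k + (i - k))" for i
      by simp
    then show ?thesis
      unfolding verts_eq by blast
  qed
  have "edge i = {v (k + (i - k)), v (k + (i - k + 1))}" for i
    by (simp add: algebra_simps)
  moreover have "{v (k + i), v (k + (i + 1))} = edge (k + i)" for i
    by (simp add: add.assoc)
  ultimately show "edges G = range (\<lambda>i. {v (k + i), v (k + (i + 1))})"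
    unfolding edges_eq by blast
qed (rule n_ge_3)

lemma reflected: "cyclic_labelling G n (\<lambda>i. v (- i))"
proof
  show "v (- i) = v (- j) \<longleftrightarrow> i mod int n = j mod int n" for i j
    by (simp add: v_eq_iff mod_eq_dvd_iff dvd_diff_commute)
  show "verts G = range (\<lambda>i. v (- i))"
  proof -
    have "v i = v (- (- i))" for i
      by simp
    then show ?thesis
      unfolding verts_eq by blast
  qed
  have "edge i = {v (- (- i - 1)), v (- (- i - 1 + 1))}" for i
    by (simp add: insert_commute add.commute)
  moreover have "{v (- i), v (- (i + 1))} = edge (- i - 1)" for i
    by (simp add: insert_commute)
  ultimately show "edges G = range (\<lambda>i. {v (- i), v (- (i + 1))})"
    unfolding edges_eq by blast
qed (rule n_ge_3)

end

section \<open>Labellings of a given cycle graph\<close>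

lemma cycle_graph_imp_labelling:
  assumes "cycle_graph G"
  obtains n v where "cyclic_labelling G n v"
proof -
  obtain vs where vs: "distinct vs" "length vs \<ge> 3" "set vs = verts G"
    "edges G = {{vs ! i, vs ! (Suc i mod length vs)} | i. i < length vs}"
    using assms unfolding cycle_graph_def by blast
  define n where "n = length vs"
  define v where "v i = vs ! nat (i mod int n)" for i
  have n: "n \<ge> 3"
    using vs(2) by (simp add: n_def)
  have less: "nat (i mod int n) < n" for i
    using n by (simp add: nat_less_iff)
  have v_int: "v (int i) = vs ! i" "v (int i + 1) = vs ! (Suc i mod n)" if "i < n" for i
    using that by (simp_all add: v_def nat_mod_distrib nat_add_distrib)
  have mod_int: "\<exists>k<n. i mod int n = int k" for i
    using less[of i] n by (intro exI[of _ "nat (i mod int n)"]) simp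
  have v_mod: "v (i mod int n) = v i" "v (i mod int n + 1) = v (i + 1)" for i
    by (simp_all add: v_def mod_add_left_eq)
  have rep: "\<exists>k<n. v i = v (int k) \<and> v (i + 1) = v (int k + 1)" for i
    using mod_int[of i] v_mod[of i] by metis
  have "cyclic_labelling G n v"
  proof
    show "v i = v j \<longleftrightarrow> i mod int n = j mod int n" for i j
    proof -
      have "v i = v j \<longleftrightarrow> nat (i mod int n) = nat (j mod int n)"
        using vs(1) less[of i] less[of j] by (simp add: v_def n_def nth_eq_iff_index_eq)
      then show ?thesis
        using n by (simp add: eq_nat_nat_iff)
    qed
    show "verts G = range v"
    proof -
      have "vs ! i \<in> range v" if "i < n" for i
        using v_int(1)[OF that] by (metis rangeI)
      moreover have "v i \<in> set vs" for i
        using less[of i] by (simp add: v_def n_def)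
      ultimately show ?thesis
        unfolding vs(3)[symmetric] by (auto simp: in_set_conv_nth n_def)
    qed
    have "edges G = {{v (int i), v (int i + 1)} | i. i < n}"
      unfolding vs(4) using v_int by (auto simp: n_def) metis+
    then show "edges G = range (\<lambda>i. {v i, v (i + 1)})"
      using rep by (auto simp: image_iff) metis
  qed (rule n)
  then show ?thesis
    by (rule that)
qed

text \<open>A shift moves the origin to \<open>s\<close>; then \<open>u\<close> sits at position 1
  or -1, and in the second case a reflection corrects the orientation.\<close>

lemma cycle_graph_imp_oriented_labelling:
  assumes "cycle_graph G" "s \<in> verts G" "{s, u} \<in> edges G"
  obtains n v where "cyclic_labelling G n v" "v 0 = s" "v 1 = u"
proof -
  obtain n v where "cyclic_labelling G n v"
    using cycle_graph_imp_labelling[OF assms(1)] .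
  then interpret cyclic_labelling G n v .
  obtain k where k: "v k = s"
    using assms(2) verts_eq by auto
  interpret sh: cyclic_labelling G n "\<lambda>i. v (k + i)"
    by (rule shifted)
  from assms(3) have "u = v (k - 1) \<or> u = v (k + 1)"
    unfolding k[symmetric] edge_mem_iff .
  then show ?thesis
    using that[OF sh.cyclic_labelling_axioms] that[OF sh.reflected] k by auto
qed


section \<open>Lower bound for exploration tours\<close>

definition traversals :: "'v list \<Rightarrow> 'v set \<Rightarrow> nat" where
  "traversals w e = card {t. t < length w - 1 \<and> {w ! t, w ! Suc t} = e}"

lemma successively_edge_nth:
  assumes "successively P w" "t < length w - 1"
  shows "P (w ! t) (w ! Suc t)"
  using assms by (simp add: successively_conv_nth)

lemma walk_cost_eq_sum_traversals:
  assumes "finite (edges G)" "successively (\<lambda>u v. {u, v} \<in> edges G) w"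
  shows "walk_cost G w = (\<Sum>e\<in>edges G. real (traversals w e) * weight G e)"
proof -
  have "walk_cost G w =
      (\<Sum>e\<in>edges G. \<Sum>t\<in>{t \<in> {..<length w - 1}. {w ! t, w ! Suc t} = e}.
        weight G {w ! t, w ! Suc t})"
    unfolding walk_cost_def using assms
    by (intro sum.group[symmetric]) (auto dest: successively_edge_nth)
  also have "\<dots> = (\<Sum>e\<in>edges G. real (traversals w e) * weight G e)"
    by (intro sum.cong) (auto simp: traversals_def)
  finally show ?thesis .
qed

lemma ex_switch:
  fixes P :: "nat \<Rightarrow> bool"
  assumes "i \<le> j" "P i \<noteq> P j"
  shows "\<exists>t. i \<le> t \<and> t < j \<and> P t \<noteq> P (Suc t)"
  using assms
proof (induction j rule: dec_induct)
  case (step j)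
  then show ?case
    by (metis less_Suc_eq)
qed simp

text \<open>At some time the walk is on the side opposite to its start. It changes sides before that
  time, and again after it because it ends where it began.\<close>

lemma closed_walk_crosses_twice:
  assumes "w \<noteq> []" "hd w = last w" "a \<in> set w" "a \<in> S" "b \<in> set w" "b \<notin> S"
  shows "card {t. t < length w - 1 \<and> (w ! t \<in> S) \<noteq> (w ! Suc t \<in> S)} \<ge> 2"
proof -
  let ?P = "\<lambda>t. w ! t \<in> S"
  have closed: "?P 0 = ?P (length w - 1)"
    using assms(1,2) by (simp add: hd_conv_nth last_conv_nth)
  obtain i where i: "i < length w" "?P i \<noteq> ?P 0"
    using assms(3-6) by (metis in_set_conv_nth)
  obtain t where t: "t < i" "?P t \<noteq> ?P (Suc t)"
    using ex_switch[of 0 i ?P] i by auto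
  obtain t' where t': "i \<le> t'" "t' < length w - 1" "?P t' \<noteq> ?P (Suc t')"
    using ex_switch[of i "length w - 1" ?P] i closed by fastforce
  have "{t, t'} \<subseteq> {t. t < length w - 1 \<and> ?P t \<noteq> ?P (Suc t)}"
    using t t' by auto
  from card_mono[OF _ this] show ?thesis
    using t t' by simp
qed

context cyclic_labelling
begin

text \<open>Positions \<open>i + 1\<close> to \<open>j\<close> form one of the two arcs left when
  both edges are removed. A tour visits both arcs and can change between them only along these two
  edges.\<close>

lemma traversals_two_edges:
  assumes "exploration_tour G s w" "i < j" "j < i + int n"
  shows "traversals w (edge i) + traversals w (edge j) \<ge> 2"
proof -
  let ?S = "v ` {i+1..j}"
  let ?T = "\<lambda>e. {t. t < length w - 1 \<and> {w ! t, w ! Suc t} = e}"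
  note tour = assms(1)[unfolded exploration_tour_def]
  have "v i \<notin> ?S"
    using assms by (subst v_mem_image_iff) auto
  then have "2 \<le> card {t. t < length w - 1 \<and> (w ! t \<in> ?S) \<noteq> (w ! Suc t \<in> ?S)}"
    using tour assms(2)
    by (intro closed_walk_crosses_twice[of w "v j" _ "v i"]) (auto simp: verts_eq)
  also have "\<dots> \<le> card (?T (edge i) \<union> ?T (edge j))"
  proof (intro card_mono subsetI)
    fix t assume t: "t \<in> {t. t < length w - 1 \<and> (w ! t \<in> ?S) \<noteq> (w ! Suc t \<in> ?S)}"
    then have "{w ! t, w ! Suc t} \<in> edges G"
      using successively_edge_nth[of _ w t] tour by auto
    \<comment> \<open>With \<open>k\<close> in the window starting at \<open>i\<close>, membership
      of both ends in the arc can be read off from the positions \<open>k\<close> and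
      \<open>k + 1\<close>.\<close>
    then obtain k where k: "k \<in> {i..<i + int n}" "{w ! t, w ! Suc t} = edge k"
      unfolding edges_eq_image[of i] by auto
    from k(2) have "(v k \<in> ?S) \<noteq> (v (k + 1) \<in> ?S)"
      using t unfolding doubleton_eq_iff by (elim disjE conjE) simp_all
    moreover have "v k \<in> ?S \<longleftrightarrow> k \<in> {i+1..j}"
      using k(1) assms(2,3) by (intro v_mem_image_iff) auto
    moreover have "v (k + 1) \<in> ?S \<longleftrightarrow> k + 1 \<in> {i+1..j}"
      using k(1) assms(2,3) by (intro v_mem_image_iff) auto
    ultimately have "k = i \<or> k = j"
      using k(1) by auto
    then show "t \<in> ?T (edge i) \<union> ?T (edge j)"
      using t k(2) by auto
  qed auto
  also have "\<dots> \<le> traversals w (edge i) + traversals w (edge j)"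
    unfolding traversals_def by (rule card_Un_le)
  finally show ?thesis .
qed

lemma tour_cost_lower_bound:
  assumes "positive_weights G" "exploration_tour G s w"
  shows "walk_cost G w \<ge> (\<Sum>e\<in>edges G. weight G e) \<or>
    (\<exists>e0\<in>edges G. walk_cost G w \<ge> 2 * ((\<Sum>e\<in>edges G. weight G e) - weight G e0))"
proof (cases "\<forall>e\<in>edges G. traversals w e \<ge> 1")
  case True
  have "weight G e \<le> real (traversals w e) * weight G e" if "e \<in> edges G" for e
  proof -
    have "1 \<le> real (traversals w e)" "0 \<le> weight G e"
      using True that assms(1) by (force simp: positive_weights_def)+
    then show ?thesis
      using mult_right_mono[of 1 "real (traversals w e)" "weight G e"] by simp
  qed
  then show ?thesis
    using walk_cost_eq_sum_traversals[OF finite_edges, of w] assms(2)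
    by (simp add: exploration_tour_def sum_mono)
next
  case False
  then obtain i where i: "traversals w (edge i) = 0"
    unfolding edges_eq by (auto simp: not_le)
  have e0: "edge i \<in> edges G"
    unfolding edges_eq by blast
  have "2 * weight G e \<le> real (traversals w e) * weight G e" if e: "e \<in> edges G - {edge i}" for e
  proof -
    obtain j where j: "j \<in> {i..<i + int n}" "e = edge j"
      using e unfolding edges_eq_image[of i] by blast
    then have "i < j"
      using e by (cases "j = i") auto
    then have "2 \<le> traversals w e"
      using traversals_two_edges[OF assms(2), of i j] j i by simp
    then show ?thesis
      using assms(1) e by (intro mult_right_mono) (force simp: positive_weights_def)+
  qed
  then have "(\<Sum>e\<in>edges G - {edge i}. 2 * weight G e)
      \<le> (\<Sum>e\<in>edges G - {edge i}. real (traversals w e) * weight G e)"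
    by (rule sum_mono)
  also have "\<dots> = walk_cost G w"
    using walk_cost_eq_sum_traversals[OF finite_edges, of w] assms(2) i
      sum.remove[OF finite_edges e0, of "\<lambda>e. real (traversals w e) * weight G e"]
    by (simp add: exploration_tour_def)
  finally have "2 * ((\<Sum>e\<in>edges G. weight G e) - weight G (edge i)) \<le> walk_cost G w"
    using sum.remove[OF finite_edges e0, of "weight G"]
    by (simp add: sum_distrib_left[symmetric])
  then show ?thesis
    using e0 by blast
qed

end


section \<open>The algorithm\<close>

text \<open>The bits are read as a binary number, least significant bit first.\<close>

definition advice_value :: "bool list \<Rightarrow> nat" where
  "advice_value = horner_sum of_bool 2"

lemma ex_advice:
  assumes "m < 2 ^ k"
  obtains adv where "length adv = k" "advice_value adv = m"
proof
  show "length (map (bit m) [0..<k]) = k"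
    by simp
  show "advice_value (map (bit m) [0..<k]) = m"
    using assms by (simp add: advice_value_def horner_sum_bit_eq_take_bit take_bit_nat_eq_self)
qed

definition unvisited :: "'v view list \<Rightarrow> 'v set" where
  "unvisited h = dom (snd (last h)) - fst ` set h"

text \<open>\<open>arg_min_on\<close> settles ties by a fixed choice, so the algorithm is
  deterministic. The labelling is later oriented to agree with that choice.\<close>

definition nearest :: "'v view \<Rightarrow> 'v set \<Rightarrow> 'v" where
  "nearest x U = arg_min_on (\<lambda>u. the (snd x u)) U"

text \<open>The vertex from which the current vertex was entered for the first time. Not used for the
  start vertex, where the truncated subtraction would return the start vertex itself.\<close>

definition parent :: "'v list \<Rightarrow> 'v" where
  "parent w = w ! ((LEAST i. w ! i = last w) - 1)"

text \<open>Depth-first search, nearest vertex first. A positive advice value \<open>m\<close> makes the searcher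
  return to the start after \<open>m\<close> steps and then search on the other side; the value \<open>0\<close> makes it
  close the cycle when no unvisited neighbour is left.\<close>

definition explore :: "'v algorithm" where
  "explore adv h =
    (let w = map fst h; t = length h - 1; m = advice_value adv; U = unvisited h in
     if U \<noteq> {} \<and> \<not> (m \<le> t \<and> t < 2 * m) then Some (nearest (last h) U)
     else if last w = hd w then None
     else if m = 0 then Some (hd w)
     else Some (parent w))"

lemma partial_run_map:
  assumes "\<And>t. t < T \<Longrightarrow> A adv (map (local_view G) (map x [0..<Suc t])) = Some (x (Suc t))"
    and "\<And>t. t < T \<Longrightarrow> {x t, x (Suc t)} \<in> edges G"
  shows "partial_run A adv G (x 0) (map x [0..<Suc T])"
  using assms
proof (induction T)
  case 0
  then show ?case
    by (simp add: partial_run.start)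
next
  case (Suc T)
  have "partial_run A adv G (x 0) (map x [0..<Suc T] @ [x (Suc T)])"
    using Suc.prems by (intro partial_run.move Suc.IH) auto
  then show ?case
    by simp
qed

lemma partial_run_successively:
  "partial_run A adv G s w \<Longrightarrow> w \<noteq> [] \<and> hd w = s \<and> successively (\<lambda>u v. {u, v} \<in> edges G) w"
  by (induction rule: partial_run.induct) (auto simp: successively_append_iff)

lemma walk_cost_map:
  "walk_cost G (map x [0..<Suc T]) = (\<Sum>t<T. weight G {x t, x (Suc t)})"
  unfolding walk_cost_def by (intro sum.cong) (auto simp del: upt_Suc)

lemma image_int_atMost: "int ` {..t} = {0..int t}"
  by (simp add: atLeast0AtMost[symmetric] image_int_atLeastAtMost)

lemma nearest_singleton [simp]: "nearest x {u} = u"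
  using arg_min_if_finite(1)[of "{u}"] by (simp add: nearest_def)

lemma cost_opt_eqI:
  assumes "exploration_tour G s w"
    and "\<And>w'. exploration_tour G s w' \<Longrightarrow> walk_cost G w \<le> walk_cost G w'"
  shows "walk_cost G w = cost_opt G s"
  unfolding cost_opt_def using assms by (intro cInf_eq_minimum[symmetric]) auto

section \<open>Evaluating the algorithm along walks lifted to the integers\<close>

context cyclic_labelling
begin

text \<open>\<open>p\<close> lifts the walk to the integer line: \<open>p t\<close> is the position
  at time \<open>t\<close>, and the list ends with the vertex reached after \<open>t\<close>
  steps.\<close>

definition walk :: "(nat \<Rightarrow> int) \<Rightarrow> nat \<Rightarrow> 'v list" where
  "walk p t = map (\<lambda>i. v (p i)) [0..<Suc t]"

definition fresh :: "(nat \<Rightarrow> int) \<Rightarrow> nat \<Rightarrow> 'v set" where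
  "fresh p t = {v (p t - 1), v (p t + 1)} - v ` p ` {..t}"

lemma dom_local_view: "dom (snd (local_view G (v i))) = {v (i - 1), v (i + 1)}"
  by (auto simp: local_view_def dom_def edge_mem_iff)

lemma last_walk [simp]: "last (walk p t) = v (p t)"
  and hd_walk [simp]: "hd (walk p t) = v (p 0)"
  by (simp_all add: walk_def hd_conv_nth nth_append del: upt_Suc)
     (simp add: last_map)

lemma walk_nth [simp]: "i \<le> t \<Longrightarrow> walk p t ! i = v (p i)"
  by (simp add: walk_def del: upt_Suc)

lemma set_walk: "set (walk p t) = v ` p ` {..t}"
  unfolding walk_def by (auto simp del: upt_Suc)

lemma unvisited_walk: "unvisited (map (local_view G) (walk p t)) = fresh p t"
proof -
  have "walk p t \<noteq> []"
    by (simp add: walk_def)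
  moreover have "fst ` local_view G ` X = X" for X
    by (auto simp: local_view_def image_iff)
  ultimately show ?thesis
    by (simp add: unvisited_def last_map dom_local_view fresh_def set_walk)
qed

lemma explore_walk:
  "explore adv (map (local_view G) (walk p t)) =
    (let m = advice_value adv in
     if fresh p t \<noteq> {} \<and> \<not> (m \<le> t \<and> t < 2 * m)
       then Some (nearest (local_view G (v (p t))) (fresh p t))
     else if v (p t) = v (p 0) then None
     else if m = 0 then Some (v (p 0))
     else Some (parent (walk p t)))"
proof -
  have "walk p t \<noteq> []" "length (walk p t) - 1 = t"
    by (simp_all add: walk_def)
  moreover have "map fst (map (local_view G) w) = w" for w
    by (induction w) (auto simp: local_view_def)
  ultimately show ?thesis
    unfolding explore_def by (simp add: unvisited_walk last_map Let_def del: map_map)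
qed

lemma run_is_tour:
  assumes "\<And>t. t < T \<Longrightarrow> explore adv (map (local_view G) (walk p t)) = Some (v (p (Suc t)))"
    and "explore adv (map (local_view G) (walk p T)) = None"
    and "\<And>t. t < T \<Longrightarrow> \<bar>p (Suc t) - p t\<bar> = 1"
    and "v (p T) = v (p 0)" and "v ` p ` {..T} = range v"
  shows "complete_run explore adv G (v (p 0)) (walk p T)"
    and "exploration_tour G (v (p 0)) (walk p T)"
proof -
  have "{v (p t), v (p (Suc t))} \<in> edges G" if "t < T" for t
  proof -
    have "p (Suc t) = p t - 1 \<or> p (Suc t) = p t + 1"
      using assms(3)[OF that] by linarith
    then show ?thesis
      unfolding edge_mem_iff by auto
  qed
  then have run: "partial_run explore adv G (v (p 0)) (walk p T)"
    using assms(1) partial_run_map[of T explore adv G "\<lambda>t. v (p t)"]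
    by (simp add: walk_def del: upt_Suc)
  then show "complete_run explore adv G (v (p 0)) (walk p T)"
    using assms(2) by (simp add: complete_run_def)
  show "exploration_tour G (v (p 0)) (walk p T)"
    using partial_run_successively[OF run] assms(4,5)
    by (simp add: exploration_tour_def set_walk verts_eq)
qed

text \<open>The hypotheses make \<open>Suc k\<close> the time of the first visit to the current
  vertex, so it was entered from \<open>v (p k)\<close>.\<close>

lemma parent_walk:
  assumes "k < t" "p t = p (Suc k)"
    and "\<And>i. i \<le> k \<Longrightarrow> v (p i) \<noteq> v (p t)"
  shows "parent (walk p t) = v (p k)"
proof -
  have "(LEAST i. walk p t ! i = v (p t)) = Suc k"
  proof (rule Least_equality)
    show "walk p t ! Suc k = v (p t)"
      using assms by simp
    show "Suc k \<le> i" if "walk p t ! i = v (p t)" for i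
      using that assms(1) assms(3)[of i] by (cases "i \<le> k") auto
  qed
  then show ?thesis
    using assms(1) by (simp add: parent_def)
qed

lemma fresh_eq:
  assumes "p ` {..t} = {a..b}"
  shows "fresh p t = {v (p t - 1), v (p t + 1)} - v ` {a..b}"
  by (simp add: fresh_def assms)


text \<open>Two unvisited neighbours compete only at the start, where \<open>near\<close> decides.
  Later the vertex behind is visited already, and \<open>Suc t < n\<close> keeps the one ahead
  new.\<close>

lemma nearest_fresh_forward:
  assumes near: "nearest (local_view G (v 0)) {v (-1), v 1} = v 1"
    and p: "p ` {..t} = {0..int t}" "p t = int t" and t: "Suc t < n"
  shows "fresh p t \<noteq> {}" "nearest (local_view G (v (p t))) (fresh p t) = v (int t + 1)"
proof -
  have next_new: "v (int t + 1) \<notin> v ` {0..int t}"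
    using t by (subst v_mem_image_iff) auto
  show "fresh p t \<noteq> {}"
    unfolding fresh_eq[OF p(1)] p(2) using next_new by auto
  show "nearest (local_view G (v (p t))) (fresh p t) = v (int t + 1)"
  proof (cases "t = 0")
    case True
    have "v (-1) \<notin> v ` {0..int t}"
      using t True by (subst v_mem_image_iff) auto
    then have "fresh p t = {v (-1), v 1}"
      unfolding fresh_eq[OF p(1)] p(2) using next_new True by auto
    then show ?thesis
      using near True p(2) by simp
  next
    case False
    then have "v (int t - 1) \<in> v ` {0..int t}"
      by (intro imageI) auto
    then have "fresh p t = {v (int t + 1)}"
      unfolding fresh_eq[OF p(1)] p(2) using next_new by auto
    then show ?thesis
      by simp
  qed
qed

lemma fresh_empty:
  assumes "v ` p ` {..t} = range v"
  shows "fresh p t = {}"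
  unfolding fresh_def assms by auto

section \<open>Round trip for advice value 0\<close>

lemma explore_full_tour:
  assumes near: "nearest (local_view G (v 0)) {v (-1), v 1} = v 1"
    and adv: "advice_value adv = 0"
  shows "complete_run explore adv G (v 0) (walk int n)" "exploration_tour G (v 0) (walk int n)"
    and "walk_cost G (walk int n) = (\<Sum>e\<in>edges G. weight G e)"
proof -
  have all: "v ` int ` {..t} = range v" if "n \<le> Suc t" for t
  proof -
    have "v ` {0..<0 + int n} \<subseteq> v ` {0..int t}"
      using that by (intro image_mono) auto
    then show ?thesis
      unfolding image_int_atMost range_v by auto
  qed
  have step: "explore adv (map (local_view G) (walk int t)) = Some (v (int (Suc t)))" if "t < n" for t
  proof (cases "Suc t < n")
    \<comment> \<open>For advice value 0 no time satisfies
      \<open>m \<le> t \<and> t < 2 * m\<close>, so the search is never interrupted.\<close>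
    case True
    then show ?thesis
      using nearest_fresh_forward[OF near image_int_atMost refl True]
      by (simp add: explore_walk adv add.commute)
  next
    \<comment> \<open>After \<open>n - 1\<close> steps every vertex is visited but the searcher is
      not at the start, so it closes the cycle along the last edge.\<close>
    case False
    then have "Suc t = n"
      using that by simp
    moreover have "v (int t) \<noteq> v 0"
      using v_eq_imp_eq[of "int t" 0] that n_ge_3 \<open>Suc t = n\<close> by auto
    moreover have "v (int n) = v 0"
      using v_add_period[of 0] by simp
    ultimately show ?thesis
      using fresh_empty[OF all[of t]] by (simp add: explore_walk adv)
  qed
  have closed: "v (int n) = v (int 0)"
    using v_add_period[of 0] by simp
  have stop: "explore adv (map (local_view G) (walk int n)) = None"
    using fresh_empty[OF all[of n]] closed by (simp add: explore_walk adv)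
  have unit_steps: "\<bar>int (Suc t) - int t\<bar> = 1" for t
    by simp
  note tour = run_is_tour[of n adv int, OF step stop unit_steps closed all]
  show "complete_run explore adv G (v 0) (walk int n)" "exploration_tour G (v 0) (walk int n)"
    using tour by simp_all
  have "walk_cost G (walk int n) = (\<Sum>t<n. weight G (edge (int t)))"
    unfolding walk_def walk_cost_map by (simp add: add.commute)
  also have "\<dots> = (\<Sum>i\<in>{0..<0 + int n}. weight G (edge i))"
    by (rule sum.reindex_bij_witness[of _ nat int]) auto
  finally show "walk_cost G (walk int n) = (\<Sum>e\<in>edges G. weight G e)"
    by (simp add: sum_edges[of _ 0])
qed

section \<open>Detour for a positive advice value\<close>

text \<open>Positions of the walk that avoids the edge between \<open>v m\<close> and \<open>v (m + 1)\<close>: from \<open>0\<close> up to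
  \<open>m\<close>, down to \<open>m + 1 - n\<close> and back to \<open>0\<close>.\<close>

definition detour :: "nat \<Rightarrow> nat \<Rightarrow> int" where
  "detour m t =
    (if t \<le> m then int t else if t < n + m then 2 * int m - int t else int t - 2 * (int n - 1))"

lemma detour_image:
  assumes "m < n" "t \<le> 2 * (n - 1)"
  shows "detour m ` {..t} = {min 0 (max (2 * int m - int t) (int m + 1 - int n))..min (int t) (int m)}"
    (is "_ = ?I")
proof (intro equalityI subsetI)
  fix x assume "x \<in> detour m ` {..t}"
  then show "x \<in> ?I"
    using assms by (auto simp: detour_def)
next
  fix x assume x: "x \<in> ?I"
  show "x \<in> detour m ` {..t}"
  \<comment> \<open>A position \<open>x \<ge> 0\<close> is first reached at time \<open>x\<close> on
    the way out, a negative one at time \<open>2 * m - x\<close> on the way down.\<close>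
  proof (cases "0 \<le> x")
    case True
    then show ?thesis
      using x by (intro image_eqI[of _ _ "nat x"]) (auto simp: detour_def)
  next
    case False
    then show ?thesis
      using x by (intro image_eqI[of _ _ "nat (2 * int m - x)"]) (auto simp: detour_def)
  qed
qed

text \<open>Deleting \<open>edge m\<close> leaves a path with \<open>n - 1\<close> edges. The walk
  is its depth-first traversal from position 0, which uses each of them twice; hence
  \<open>T\<close>.\<close>

lemma explore_detour:
  assumes near: "nearest (local_view G (v 0)) {v (-1), v 1} = v 1"
    and adv: "advice_value adv = m" and m: "0 < m" "m < n"
  defines "T \<equiv> 2 * (n - 1)"
  shows "complete_run explore adv G (v 0) (walk (detour m) T)"
    and "exploration_tour G (v 0) (walk (detour m) T)"
    and "walk_cost G (walk (detour m) T) =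
      2 * ((\<Sum>e\<in>edges G. weight G e) - weight G (edge (int m)))"
proof -
  let ?p = "detour m"
  have p_0: "?p 0 = 0" and p_T: "?p T = 0"
    using m by (auto simp: detour_def T_def)
  have image: "?p ` {..t} = {min 0 (max (2 * int m - int t) (int m + 1 - int n))..min (int t) (int m)}"
    if "t \<le> T" for t
    using detour_image m(2) that by (simp add: T_def)
  \<comment> \<open>At time \<open>n + m - 1\<close> the lowest position \<open>m + 1 - n\<close> is
    reached, and the visited positions fill a window of length \<open>n\<close>.\<close>
  have all: "v ` ?p ` {..t} = range v" if "n + m \<le> Suc t" "t \<le> T" for t
  proof -
    have "?p ` {..t} = {int m + 1 - int n..<(int m + 1 - int n) + int n}"
      unfolding image[OF that(2)] using that m by auto
    then show ?thesis
      by (simp only: range_v)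
  qed
  \<comment> \<open>All positions lie in one window of length \<open>n\<close>, so a vertex
    determines its position.\<close>
  have p_eq: "?p i = ?p j" if "v (?p i) = v (?p j)" "i \<le> T" "j \<le> T" for i j
  proof -
    have bounds: "?p k \<in> {int m + 1 - int n..int m}" if "k \<le> T" for k
      using that m by (auto simp: detour_def T_def)
    show ?thesis
      using v_eq_imp_eq[OF that(1)] bounds[OF that(2)] bounds[OF that(3)] by simp
  qed
  have step: "explore adv (map (local_view G) (walk ?p t)) = Some (v (?p (Suc t)))" if t: "t < T" for t
  proof -
    \<comment> \<open>The phases are the search forward, the return forced by the advice, the search
      on the other side, and the final backtracking.\<close>
    consider (out) "t < m" | (undo) "m \<le> t" "t < 2 * m" | (down) "2 * m \<le> t" "Suc t < n + m"
      | (up) "n + m \<le> Suc t"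
      using m by linarith
    then show ?thesis
    proof cases
      case out
      then have "?p ` {..t} = {0..int t}" "?p t = int t"
        using image[of t] t by (auto simp: detour_def)
      moreover have "?p (Suc t) = int t + 1"
        using out by (simp add: detour_def)
      ultimately show ?thesis
        using nearest_fresh_forward[OF near, of ?p t] out m by (simp add: explore_walk adv)
    next
      case undo
      \<comment> \<open>The current position \<open>2 * m - t\<close> was first reached on the way
        out, at the time equal to it.\<close>
      define k where "k = 2 * m - t - 1"
      have k: "Suc k = 2 * m - t" "k < m" "k < t"
        using undo by (auto simp: k_def)
      have eqs: "?p t = int (Suc k)" "?p (Suc k) = int (Suc k)" "?p k = int k" "?p (Suc t) = int k"
        using k undo m by (auto simp: detour_def)
      have ne: "v (?p i) \<noteq> v (?p t)" if "i \<le> k" for i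
        using p_eq[of i t] that k eqs t by (auto simp: detour_def)
      have "parent (walk ?p t) = v (?p (Suc t))"
        using parent_walk[of k t ?p] k eqs ne by simp
      moreover have "v (?p t) \<noteq> v (?p 0)"
        using ne[of 0] by simp
      ultimately show ?thesis
        using undo m by (simp add: explore_walk adv)
    next
      case down
      have p_t: "?p t = 2 * int m - int t" "?p (Suc t) = ?p t - 1"
        using down m by (auto simp: detour_def)
      have im: "?p ` {..t} = {?p t..int m}"
        unfolding image[OF less_imp_le[OF t]] p_t using down m by auto
      have "v (?p t - 1) \<notin> v ` {?p t..int m}"
        using down p_t m by (subst v_mem_image_iff) auto
      \<comment> \<open>Here \<open>m > 0\<close> matters: at time \<open>2 * m\<close> the searcher
        is back at 0, and \<open>v 1\<close> must count as visited.\<close>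
      moreover have "v (?p t + 1) \<in> v ` {?p t..int m}"
        using down p_t m by (intro imageI) auto
      ultimately have "fresh ?p t = {v (?p (Suc t))}"
        unfolding fresh_eq[OF im] p_t(2) by auto
      then show ?thesis
        using down by (simp add: explore_walk adv)
    next
      case up
      \<comment> \<open>The current position was first reached on the way down. Solving
        \<open>2 * m - Suc k = t - 2 * (n - 1)\<close> gives \<open>k\<close>.\<close>
      define k where "k = 2 * (m + n - 1) - t - 1"
      have k: "Suc k = 2 * (m + n - 1) - t" "2 * m \<le> k" "Suc k < n + m" "k < t"
        using up t m by (auto simp: k_def T_def)
      have eqs: "?p t = int t - 2 * (int n - 1)" "?p (Suc k) = ?p t" "?p k = ?p t + 1"
        "?p (Suc t) = ?p t + 1"
        using k up m t by (auto simp: detour_def T_def)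
      have ne: "v (?p i) \<noteq> v (?p t)" if "i \<le> k" for i
        using p_eq[of i t] that k eqs t m up by (auto simp: detour_def T_def split: if_splits)
      have "parent (walk ?p t) = v (?p (Suc t))"
        using parent_walk[of k t ?p] k eqs ne by auto
      moreover have "v (?p t) \<noteq> v (?p 0)"
        using ne[of 0] by simp
      ultimately show ?thesis
        using up m t fresh_empty[OF all[of t]] by (simp add: explore_walk adv)
    qed
  qed
  have "n + m \<le> Suc T"
    using m by (simp add: T_def)
  note all_T = all[OF this order_refl]
  have stop: "explore adv (map (local_view G) (walk ?p T)) = None"
    using fresh_empty[OF all_T] p_0 p_T by (simp add: explore_walk adv)
  have unit_steps: "\<bar>?p (Suc t) - ?p t\<bar> = 1" if "t < T" for t
    using that m by (auto simp: detour_def T_def)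
  have closed: "v (?p T) = v (?p 0)"
    by (simp add: p_0 p_T)
  note tour = run_is_tour[of T adv ?p, OF step stop unit_steps closed all_T]
  show "complete_run explore adv G (v 0) (walk ?p T)" "exploration_tour G (v 0) (walk ?p T)"
    using tour by (simp_all add: p_0)
  define g where "g i = weight G (edge i)" for i
  \<comment> \<open>This is the lower turning position. The walk goes from 0 to \<open>m\<close>,
    down to \<open>a\<close> and up to 0, and the cost is split accordingly.\<close>
  define a where "a = int m + 1 - int n"
  let ?c = "\<lambda>t. weight G {v (?p t), v (?p (Suc t))}"
  have c_up: "?c t = g (?p t)" if "?p (Suc t) = ?p t + 1" for t
    by (simp add: g_def that)
  have c_down: "?c t = g (?p t - 1)" if "?p (Suc t) = ?p t - 1" for t
    by (simp add: g_def that insert_commute)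
  have "walk_cost G (walk ?p T) = (\<Sum>t\<in>{0..<T}. ?c t)"
    unfolding walk_def walk_cost_map by (simp add: atLeast0LessThan)
  also have "\<dots> = (\<Sum>t\<in>{0..<m}. ?c t) + (\<Sum>t\<in>{m..<n+m-1}. ?c t) + (\<Sum>t\<in>{n+m-1..<T}. ?c t)"
    using m by (simp add: sum.atLeastLessThan_concat T_def)
  also have "(\<Sum>t\<in>{0..<m}. ?c t) = (\<Sum>i\<in>{0..<int m}. g i)"
    by (rule sum.reindex_bij_witness[of _ nat int]) (auto simp: detour_def g_def add.commute)
  also have "(\<Sum>t\<in>{m..<n+m-1}. ?c t) = (\<Sum>i\<in>{a..<int m}. g i)"
  \<comment> \<open>A step down from position \<open>2 * m - t\<close> crosses the edge labelled by
    its lower end, one less.\<close>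
  proof (rule sum.reindex_bij_witness[of _ "\<lambda>i. nat (2 * int m - 1 - i)" "\<lambda>t. 2 * int m - 1 - int t"])
    fix t assume "t \<in> {m..<n+m-1}"
    then have "?p (Suc t) = ?p t - 1" "?p t - 1 = 2 * int m - 1 - int t"
      by (auto simp: detour_def)
    then show "g (2 * int m - 1 - int t) = ?c t"
      using c_down by metis
  qed (auto simp: a_def)
  also have "(\<Sum>t\<in>{n+m-1..<T}. ?c t) = (\<Sum>i\<in>{a..<0}. g i)"
  proof (rule sum.reindex_bij_witness[of _ "\<lambda>i. nat (i + 2 * (int n - 1))" "\<lambda>t. int t - 2 * (int n - 1)"])
    fix t assume "t \<in> {n+m-1..<T}"
    then have "?p (Suc t) = ?p t + 1" "?p t = int t - 2 * (int n - 1)"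
      using m by (auto simp: detour_def T_def)
    then show "g (int t - 2 * (int n - 1)) = ?c t"
      using c_up by metis
  qed (use m in \<open>auto simp: a_def T_def\<close>)
  finally have "walk_cost G (walk ?p T) =
      (\<Sum>i\<in>{0..<int m}. g i) + (\<Sum>i\<in>{a..<int m}. g i) + (\<Sum>i\<in>{a..<0}. g i)" .
  moreover have "(\<Sum>i\<in>{a..<int m}. g i) = (\<Sum>i\<in>{a..<0}. g i) + (\<Sum>i\<in>{0..<int m}. g i)"
    using m by (subst sum.union_disjoint[symmetric]) (auto simp: a_def ivl_disj_un)
  moreover have "(\<Sum>e\<in>edges G. weight G e) = (\<Sum>i\<in>{a..<int m}. g i) + g (int m)"
  proof -
    have "{a..<a + int n} = insert (int m) {a..<int m}"
      using m by (auto simp: a_def)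
    then show ?thesis
      unfolding sum_edges[of _ a] by (simp add: g_def)
  qed
  ultimately show "walk_cost G (walk ?p T) =
      2 * ((\<Sum>e\<in>edges G. weight G e) - weight G (edge (int m)))"
    by (simp add: g_def)
qed

section \<open>Choice of the advice value and optimality\<close>

lemma explore_optimal:
  assumes pos: "positive_weights G"
    and near: "nearest (local_view G (v 0)) {v (-1), v 1} = v 1"
    and le: "weight G (edge 0) \<le> weight G (edge (-1))"
  obtains m where "m < n"
    "\<And>adv. advice_value adv = m \<Longrightarrow> \<exists>w. complete_run explore adv G (v 0) w \<and>
       exploration_tour G (v 0) w \<and> walk_cost G w = cost_opt G (v 0)"
proof -
  let ?W = "\<Sum>e\<in>edges G. weight G e"
  have nonneg: "0 \<le> weight G e" if "e \<in> edges G" for e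
    using pos that by (force simp: positive_weights_def)
  have two: "weight G e + weight G e' \<le> ?W" if "e \<in> edges G" "e' \<in> edges G" "e \<noteq> e'" for e e'
    using sum_mono2[OF finite_edges, of "{e, e'}" "weight G"] that nonneg by auto
  show ?thesis
  proof (cases "\<exists>e\<in>edges G. 2 * weight G e > ?W")
    case False
    have "\<exists>w. complete_run explore adv G (v 0) w \<and>
        exploration_tour G (v 0) w \<and> walk_cost G w = cost_opt G (v 0)"
      if adv: "advice_value adv = 0" for adv
    proof -
      note full = explore_full_tour[OF near adv]
      \<comment> \<open>Without an edge heavier than half of \<open>?W\<close>, the second
        alternative of the lower bound is at least \<open>?W\<close> as well.\<close>
      have "?W \<le> walk_cost G w" if "exploration_tour G (v 0) w" for w
        using tour_cost_lower_bound[OF pos that] False by force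
      then show ?thesis
        using full cost_opt_eqI[OF full(2)] by auto
    qed
    then show ?thesis
      using that[of 0] n_ge_3 by auto
  next
    case True
    then obtain j where j: "j \<in> {0..<0 + int n}" "2 * weight G (edge j) > ?W"
      unfolding edges_eq_image[of 0] by auto
    have in_edges: "edge i \<in> edges G" for i
      unfolding edges_eq by blast
    \<comment> \<open>This saves one option: \<open>edge 0\<close> is no heavier than
      \<open>edge (-1)\<close>, and together they weigh at most \<open>?W\<close>. The advice values
      needed are thus 0 to \<open>n - 1\<close>.\<close>
    have "j \<noteq> 0"
    proof
      assume "j = 0"
      moreover have "edge 0 \<noteq> edge (-1)"
        using edge_eq_imp[of 0 "-1"] v_eq_imp_eq[of 0 "-1"] n_ge_3 by auto
      ultimately show False
        using two[OF in_edges[of 0] in_edges[of "-1"]] j(2) le by simp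
    qed
    then obtain m where m: "j = int m" "0 < m" "m < n"
      using j(1) by (metis add_0 atLeastLessThan_iff nonneg_int_cases of_nat_0_less_iff of_nat_less_iff order_le_less)
    have "\<exists>w. complete_run explore adv G (v 0) w \<and>
        exploration_tour G (v 0) w \<and> walk_cost G w = cost_opt G (v 0)"
      if adv: "advice_value adv = m" for adv
    proof -
      note detour = explore_detour[OF near adv m(2,3)]
      have max: "weight G e \<le> weight G (edge j)" if "e \<in> edges G" for e
        using two[OF that in_edges[of j]] j(2) by (cases "e = edge j") auto
      \<comment> \<open>In the first alternative of the lower bound this holds because
        \<open>edge j\<close> exceeds half of \<open>?W\<close>; in the second because
        \<open>edge j\<close> is heaviest.\<close>
      have "2 * (?W - weight G (edge j)) \<le> walk_cost G w" if "exploration_tour G (v 0) w" for w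
        using tour_cost_lower_bound[OF pos that] max j(2) by force
      then show ?thesis
        using detour cost_opt_eqI[OF detour(2)] m(1) by auto
    qed
    then show ?thesis
      using that[of m] m by auto
  qed
qed

end

section \<open>Length of the advice and conclusion\<close>

lemma le_two_power_ceiling_log:
  assumes "n > 0"
  shows "int (nat \<lceil>log 2 (real n)\<rceil>) = \<lceil>log 2 (real n)\<rceil>" "n \<le> 2 ^ nat \<lceil>log 2 (real n)\<rceil>"
proof -
  have "0 \<le> log 2 (real n)"
    using assms by simp
  then show eq: "int (nat \<lceil>log 2 (real n)\<rceil>) = \<lceil>log 2 (real n)\<rceil>"
    by (simp add: zero_le_ceiling less_le_trans[of "-1" 0])
  have "log 2 (real n) \<le> real (nat \<lceil>log 2 (real n)\<rceil>)"
    by (metis eq le_of_int_ceiling of_int_of_nat_eq)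
  then have "real n \<le> 2 powr real (nat \<lceil>log 2 (real n)\<rceil>)"
    using assms log_le_iff[of 2 "real n"] by (metis of_nat_0_less_iff one_less_numeral_iff semiring_norm(76))
  then have "real n \<le> real (2 ^ nat \<lceil>log 2 (real n)\<rceil>)"
    by (simp add: powr_realpow del: of_nat_nat)
  then show "n \<le> 2 ^ nat \<lceil>log 2 (real n)\<rceil>"
    by (simp only: of_nat_le_iff)
qed

theorem theorem4:
  "\<exists>A :: 'v algorithm. \<forall>(G :: 'v wgraph) s.
     cycle_graph G \<and> positive_weights G \<and> s \<in> verts G \<longrightarrow>
     (\<exists>adv. int (length adv) = \<lceil>log 2 (real (card (verts G)))\<rceil> \<and>
       (\<exists>w. complete_run A adv G s w \<and> exploration_tour G s w \<and>
            walk_cost G w = cost_opt G s))"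
proof (intro exI[of _ explore] allI impI, elim conjE)
  fix G :: "'v wgraph" and s
  assume cyc: "cycle_graph G" and pos: "positive_weights G" and s: "s \<in> verts G"
  define N where "N = {u. {s, u} \<in> edges G}"
  define f where "f u = the (snd (local_view G s) u)" for u
  define u where "u = nearest (local_view G s) N"
  have u_arg_min: "u = arg_min_on f N"
    by (simp add: u_def nearest_def f_def[abs_def])
  \<comment> \<open>This preliminary labelling shows that \<open>N\<close> is finite and nonempty,
    so that the minimum defining \<open>u\<close> is attained.\<close>
  obtain n0 v0 where "cyclic_labelling G n0 v0"
    using cycle_graph_imp_labelling[OF cyc] .
  then interpret L0: cyclic_labelling G n0 v0 .
  obtain k where "v0 k = s"
    using s L0.verts_eq by auto
  then have "N = {v0 (k - 1), v0 (k + 1)}"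
    unfolding N_def using L0.edge_mem_iff[of k] by auto
  then have N: "finite N" "N \<noteq> {}"
    by auto
  from arg_min_if_finite(1)[OF this] have "{s, u} \<in> edges G"
    by (simp add: u_arg_min N_def)
  \<comment> \<open>The orientation follows the first move of the algorithm, which makes
    \<open>edge 0\<close> the lighter edge at the start.\<close>
  then obtain n v where "cyclic_labelling G n v" and v: "v 0 = s" "v 1 = u"
    using cycle_graph_imp_oriented_labelling[OF cyc s] by metis
  then interpret cyclic_labelling G n v
    by simp
  have N_eq: "N = {v (-1), v 1}"
    unfolding N_def using edge_mem_iff[of 0] v(1) by auto
  have near: "nearest (local_view G (v 0)) {v (-1), v 1} = v 1"
    using u_def N_eq v by simp
  have "f u \<le> f (v (-1))"
    using arg_min_least[OF N, of "v (-1)" f] by (simp add: u_arg_min N_eq)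
  moreover have "f x = weight G {s, x}" if "x \<in> N" for x
    using that by (simp add: f_def local_view_def N_def)
  ultimately have "weight G {v 0, v (0 + 1)} \<le> weight G {v (-1), v (-1 + 1)}"
    using N_eq v by (simp add: insert_commute)
  from explore_optimal[OF pos near this] obtain m where m: "m < n"
    "\<And>adv. advice_value adv = m \<Longrightarrow> \<exists>w. complete_run explore adv G s w \<and>
       exploration_tour G s w \<and> walk_cost G w = cost_opt G s"
    unfolding v(1) by blast
  have "n > 0"
    using n_ge_3 by simp
  note bits = le_two_power_ceiling_log[OF this]
  obtain adv where "length adv = nat \<lceil>log 2 (real n)\<rceil>" "advice_value adv = m"
    using ex_advice[of m] m(1) bits(2) by (metis less_le_trans)
  then show "\<exists>adv. int (length adv) = \<lceil>log 2 (real (card (verts G)))\<rceil> \<and>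
      (\<exists>w. complete_run explore adv G s w \<and> exploration_tour G s w \<and>
        walk_cost G w = cost_opt G s)"
    using m(2) bits(1) card_verts by metis
qed

end
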